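(* Let $(\mathcal{X},d)$ be a metric space, let $f,g:\mathcal{X}\to\mathcal{X}$ be maps and $F,G:\mathcal{X}\to\mathcal{P}_{fb}(\mathcal{X})$ be set-valued maps. Let $\Phi:[0,\infty)\to[0,\infty)$ be a nondecreasing function such that $\Phi(t)=0$ if and only if $t=0$, and let $\alpha,\beta,\gamma:[0,\infty)\to[0,1)$ be functions satisfying $\alpha(t)+\beta(t)+\gamma(t)<1$ for all $t>0$. Suppose that for all $x,y\in\mathcal{X}$, $$\begin{aligned}\Phi(\delta(Fx,Gy))\le\ & \alpha(d(fx,gy))\,\Phi(d(fx,gy))\\ &+\beta(d(fx,gy))\,[\Phi(d(fx,Gy))+\Phi(d(gy,Gy))]\\ &+\gamma(d(fx,gy))\,[\Phi(d(fx,Fx))+\Phi(d(gy,Fx))].\end{aligned}$$ If the pairs $\{f,F\}$ and $\{g,G\}$ are occasionally weakly compatible, then $f$, $g$, $F$ and $G$ have a unique common fixed point in $\mathcal{X}$.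
   Context: $\mathcal{P}_{fb}(\mathcal{X})$ is the class of all nonempty bounded closed subsets of $\mathcal{X}$. We write $fx=f(x)$, $Fx=F(x)$, and for $x\in\mathcal{X}$, $A,B\subseteq\mathcal{X}$, $d(x,A)=\inf\{d(x,y):y\in A\}$ and $\delta(A,B)=\sup\{d(a,b):a\in A,\,b\in B\}$. A pair $\{f,F\}$ with $f:\mathcal{X}\to\mathcal{X}$ and $F:\mathcal{X}\to\mathcal{P}_{fb}(\mathcal{X})$ is occasionally weakly compatible (owc) if there exists $x\in\mathcal{X}$ such that $fx\in Fx$ and $fFx\subseteq Ffx$, where $fFx=\{f(y):y\in F(x)\}$ and $Ffx=F(f(x))$. A common fixed point of $f,g,F,G$ is a point $w\in\mathcal{X}$ with $w=fw=gw$, $w\in Fw$ and $w\in Gw$. *)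

theory Defs
  imports "HOL-Analysis.Analysis"
begin

definition P_fb :: "'a::metric_space set set" where
  "P_fb = {A. A \<noteq> {} \<and> bounded A \<and> closed A}"

text \<open>The supremum is taken in the reals, so it is only meaningful for nonempty bounded sets.
  The distance from a point to a set is the library's \<^const>\<open>infdist\<close>.\<close>

definition sup_dist :: "'a::metric_space set \<Rightarrow> 'a set \<Rightarrow> real" where
  "sup_dist A B = Sup {dist a b | a b. a \<in> A \<and> b \<in> B}"

definition occasionally_weakly_compatible ::
    "('a::metric_space \<Rightarrow> 'a) \<Rightarrow> ('a \<Rightarrow> 'a set) \<Rightarrow> bool" where
  "occasionally_weakly_compatible f F \<longleftrightarrow> (\<exists>x. f x \<in> F x \<and> f ` F x \<subseteq> F (f x))"

definition common_fixed_point ::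
    "('a::metric_space \<Rightarrow> 'a) \<Rightarrow> ('a \<Rightarrow> 'a) \<Rightarrow> ('a \<Rightarrow> 'a set) \<Rightarrow> ('a \<Rightarrow> 'a set) \<Rightarrow> 'a \<Rightarrow> bool" where
  "common_fixed_point f g F G w \<longleftrightarrow> w = f w \<and> w = g w \<and> w \<in> F w \<and> w \<in> G w"

end

(* The contraction forces f x = g y whenever f x lies in F x and g y lies in G y: every distance on
   its right-hand side is then 0 or at most dist (f x) (g y), which in turn is at most
   sup_dist (F x) (G y). Applied to the points x, y given by occasional weak compatibility this
   yields w = f x = g y; since f w lies in F w and g w in G w, applying it to (x, w), (w, y) and to
   two common fixed points gives w = g w, w = f w and uniqueness. *)

theory Submission
  imports Defs
begin

text \<open>A real \<open>Sup\<close> dominates the elements of its set only if that set is bounded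
  above. Here the set is the image of the bounded product \<open>A \<times> B\<close> under the
  distance, so it is bounded.\<close>

lemma dist_le_sup_dist:
  fixes A B :: "'a::metric_space set"
  assumes "bounded A" "bounded B" "a \<in> A" "b \<in> B"
  shows "dist a b \<le> sup_dist A B"
proof -
  have "bounded ((\<lambda>(a, b). dist a b) ` (A \<times> B))"
    using assms(1,2)
    by (auto simp: case_prod_beta
        intro!: bounded_dist_comp bounded_fst bounded_snd bounded_Times)
  moreover have "(\<lambda>(a, b). dist a b) ` (A \<times> B) = {dist a b | a b. a \<in> A \<and> b \<in> B}"
    by auto
  ultimately have "bdd_above {dist a b | a b. a \<in> A \<and> b \<in> B}"
    using bounded_imp_bdd_above by metis
  then show ?thesis
    unfolding sup_dist_def using assms(3,4) by (intro cSup_upper) auto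
qed

theorem theorem3p7:
  fixes f g :: "'a::metric_space \<Rightarrow> 'a"
    and F G :: "'a \<Rightarrow> 'a set"
    and \<Phi> \<alpha> \<beta> \<gamma> :: "real \<Rightarrow> real"
  assumes F: "\<And>x. F x \<in> P_fb"
    and G: "\<And>x. G x \<in> P_fb"
    and \<Phi>_range: "\<Phi> \<in> {0..} \<rightarrow> {0..}"
    and \<Phi>_mono: "mono_on {0..} \<Phi>"
    and \<Phi>_zero: "\<And>t. t \<ge> 0 \<Longrightarrow> \<Phi> t = 0 \<longleftrightarrow> t = 0"
    and \<alpha>_range: "\<alpha> \<in> {0..} \<rightarrow> {0..<1}"
    and \<beta>_range: "\<beta> \<in> {0..} \<rightarrow> {0..<1}"
    and \<gamma>_range: "\<gamma> \<in> {0..} \<rightarrow> {0..<1}"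
    and sum_less: "\<And>t. t > 0 \<Longrightarrow> \<alpha> t + \<beta> t + \<gamma> t < 1"
    and contraction: "\<And>x y. \<Phi> (sup_dist (F x) (G y)) \<le>
          \<alpha> (dist (f x) (g y)) * \<Phi> (dist (f x) (g y))
        + \<beta> (dist (f x) (g y)) * (\<Phi> (infdist (f x) (G y)) + \<Phi> (infdist (g y) (G y)))
        + \<gamma> (dist (f x) (g y)) * (\<Phi> (infdist (f x) (F x)) + \<Phi> (infdist (g y) (F x)))"
    and owc_fF: "occasionally_weakly_compatible f F"
    and owc_gG: "occasionally_weakly_compatible g G"
  shows "\<exists>!w. common_fixed_point f g F G w"
proof -
  have coincide: "f x = g y" if x: "f x \<in> F x" and y: "g y \<in> G y" for x y
  proof (rule ccontr)
    assume "f x \<noteq> g y"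
    define t where "t = dist (f x) (g y)"
    have "t > 0"
      using \<open>f x \<noteq> g y\<close> by (simp add: t_def)
    have mono: "\<Phi> r \<le> \<Phi> s" if "0 \<le> r" "r \<le> s" for r s
      using mono_onD[OF \<Phi>_mono] that by auto
    have "\<Phi> 0 = 0"
      using \<Phi>_zero by simp
    have "t \<le> sup_dist (F x) (G y)"
      using F G x y unfolding t_def by (intro dist_le_sup_dist) (auto simp: P_fb_def)
    then have "\<Phi> t \<le> \<Phi> (sup_dist (F x) (G y))"
      using \<open>t > 0\<close> by (intro mono) auto
    also have "\<dots> \<le> \<alpha> t * \<Phi> t + \<beta> t * (\<Phi> (infdist (f x) (G y)) + \<Phi> (infdist (g y) (G y)))
        + \<gamma> t * (\<Phi> (infdist (f x) (F x)) + \<Phi> (infdist (g y) (F x)))"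
      using contraction unfolding t_def .
    \<comment> \<open>The terms for \<open>g y\<close> against \<open>G y\<close> and
      \<open>f x\<close> against \<open>F x\<close> vanish: a point of a set has
      \<open>infdist\<close> 0 to it.\<close>
    also have "\<dots> = \<alpha> t * \<Phi> t + \<beta> t * \<Phi> (infdist (f x) (G y)) + \<gamma> t * \<Phi> (infdist (g y) (F x))"
      using x y \<open>\<Phi> 0 = 0\<close> by simp
    also have "\<dots> \<le> \<alpha> t * \<Phi> t + \<beta> t * \<Phi> t + \<gamma> t * \<Phi> t"
    proof -
      \<comment> \<open>The points \<open>g y\<close> of \<open>G y\<close> and \<open>f x\<close>
        of \<open>F x\<close> witness that both mixed distances are at most
        \<open>t\<close>.\<close>
      have "\<Phi> (infdist (f x) (G y)) \<le> \<Phi> t" "\<Phi> (infdist (g y) (F x)) \<le> \<Phi> t"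
        using infdist_le[OF y, of "f x"] infdist_le[OF x, of "g y"]
        by (auto intro!: mono simp: t_def infdist_nonneg dist_commute)
      moreover have "\<beta> t \<ge> 0" "\<gamma> t \<ge> 0"
        using \<beta>_range \<gamma>_range \<open>t > 0\<close> by (auto simp: Pi_iff)
      ultimately show ?thesis
        by (intro add_mono mult_left_mono order_refl)
    qed
    also have "\<dots> = (\<alpha> t + \<beta> t + \<gamma> t) * \<Phi> t"
      by (simp add: algebra_simps)
    \<comment> \<open>Strictness needs \<open>\<Phi> t > 0\<close>, which holds because \<Phi> is
      nonnegative and vanishes only at 0. The chain then reads
      \<open>\<Phi> t < \<Phi> t\<close>.\<close>
    also have "\<dots> < 1 * \<Phi> t"
    proof (intro mult_strict_right_mono)
      show "\<alpha> t + \<beta> t + \<gamma> t < 1"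
        using sum_less \<open>t > 0\<close> .
      have "\<Phi> t \<ge> 0" "\<Phi> t \<noteq> 0"
        using \<Phi>_range \<Phi>_zero[of t] \<open>t > 0\<close> by (auto simp: Pi_iff)
      then show "\<Phi> t > 0"
        by simp
    qed
    finally show False
      by simp
  qed
  obtain x where x: "f x \<in> F x" "f ` F x \<subseteq> F (f x)"
    using owc_fF by (auto simp: occasionally_weakly_compatible_def)
  obtain y where y: "g y \<in> G y" "g ` G y \<subseteq> G (g y)"
    using owc_gG by (auto simp: occasionally_weakly_compatible_def)
  define w where "w = f x"
  have w: "w = g y"
    using coincide x y by (simp add: w_def)
  have fw: "f w \<in> F w"
    using x by (auto simp: w_def)
  have gw: "g w \<in> G w"
    using y by (auto simp: w)
  have "f w = w"
    using coincide[OF fw y(1)] by (simp only: w[symmetric])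
  have "g w = w"
    using coincide[OF x(1) gw] by (simp only: w_def[symmetric])
  show ?thesis
  proof
    show "common_fixed_point f g F G w"
      using fw gw \<open>f w = w\<close> \<open>g w = w\<close> by (simp add: common_fixed_point_def)
    \<comment> \<open>As \<open>f v = v\<close> and \<open>g w = w\<close>, the equation
      \<open>f v = g w\<close> from \<open>coincide\<close> is already \<open>v = w\<close>.\<close>
    show "v = w" if "common_fixed_point f g F G v" for v
      using coincide[of v w] that gw \<open>g w = w\<close> by (simp add: common_fixed_point_def)
  qed
qed

end
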